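(* (End-to-middle recurrence.) Let $\{Q_p(x)\}_{p\ge 0}$ be a sequence of orthogonal polynomials given by a Favard recurrence $Q_{p+1}(x)=(A_px+B_p)Q_p(x)-C_pQ_{p-1}(x)$, $p\ge 0$, $Q_0(x)=1$, $Q_{-1}(x)=0$, with coefficients as in the context. Let $p,s,t$ be integers with $1\le t\le p$ and $s\ge 1$, let $\Psi_{p+s}^{(p)},\Psi_{p+s}^{(p-1)},\psi_{p-t}^{(p)},\psi_{p-t}^{(p-1)}$ be the coefficient functions defined in the context, and put $$\mathbf K=\begin{bmatrix}\Psi_{p+s}^{(p)}(x)&\Psi_{p+s}^{(p-1)}(x)\\ \psi_{p-t}^{(p)}(x)&\psi_{p-t}^{(p-1)}(x)\end{bmatrix}.$$ Then for every real $x$ with $\Psi_{p+s}^{(p-1)}(x)\neq 0$, $\psi_{p-t}^{(p-1)}(x)\ne 0$ and $\det(\mathbf K)\neq0$, $$Q_{p}(x)=\tilde M(x)Q_{p+s}(x)+\tilde N(x)Q_{p-t}(x),\qquad \tilde M(x)=\frac{\psi_{p-t}^{(p-1)}(x)}{\det(\mathbf K)},\qquad \tilde N(x)=-\frac{\Psi_{p+s}^{(p-1)}(x)}{\det(\mathbf K)}.$$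
   Context: Favard coefficients: $(A_p)_{p\ge0},(B_p)_{p\ge0},(C_p)_{p\ge 0}$ are real sequences with $A_p\ne0$ for all $p\ge 0$, and $C_p\neq 0$ and $C_pA_pA_{p-1}>0$ for all $p\ge 1$ ($C_0$ is irrelevant since $Q_{-1}=0$). Notation: for $i\ge 1$, $S_i(x)=A_ix+B_i$, $T_i(x)=S_i(x)/C_i$, $D_i=1/C_i$. Degree-increase coefficients: for fixed $p\ge1$, the functions $\Psi_{p+s}^{(p)},\Psi_{p+s}^{(p-1)}$ ($s\ge1$) are defined by $\Psi_{p+1}^{(p)}(x)=S_p(x)$, $\Psi_{p+1}^{(p-1)}(x)=-C_p$; $\Psi_{p+2}^{(p)}(x)=S_{p+1}(x)S_p(x)-C_{p+1}$, $\Psi_{p+2}^{(p-1)}(x)=-C_pS_{p+1}(x)$; and for $s\ge3$ and each $j\in\{p,p-1\}$, $\Psi_{p+s}^{(j)}(x)=S_{p+s-1}(x)\Psi_{p+s-1}^{(j)}(x)-C_{p+s-1}\Psi_{p+s-2}^{(j)}(x)$. Degree-decrease coefficients: for fixed $p\ge1$, the functions $\psi_{p-t}^{(p)},\psi_{p-t}^{(p-1)}$ ($1\le t\le p$) are defined by $\psi_{p-1}^{(p)}(x)=0$, $\psi_{p-1}^{(p-1)}(x)=1$; $\psi_{p-2}^{(p)}(x)=-D_{p-1}$, $\psi_{p-2}^{(p-1)}(x)=T_{p-1}(x)$; and for $t\ge3$ and each $j\in\{p,p-1\}$, $\psi_{p-t}^{(j)}(x)=T_{p-t+1}(x)\psi_{p-t+1}^{(j)}(x)-D_{p-t+1}\psi_{p-t+2}^{(j)}(x)$.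 *)

theory Defs
  imports "HOL-Analysis.Analysis" "HOL-Computational_Algebra.Polynomial"
begin

definition favard_coeffs :: "(nat \<Rightarrow> real) \<Rightarrow> (nat \<Rightarrow> real) \<Rightarrow> bool" where
  "favard_coeffs A C \<longleftrightarrow>
     (\<forall>p. A p \<noteq> 0) \<and> (\<forall>p\<ge>1. C p \<noteq> 0 \<and> C p * A p * A (p - 1) > 0)"

(* The conditional encodes the convention that the polynomial of index -1 is 0. *)
definition favard_recurrence ::
  "(nat \<Rightarrow> real) \<Rightarrow> (nat \<Rightarrow> real) \<Rightarrow> (nat \<Rightarrow> real) \<Rightarrow> (nat \<Rightarrow> real poly) \<Rightarrow> bool" where
  "favard_recurrence A B C Q \<longleftrightarrow>
     Q 0 = 1 \<and>
     (\<forall>p. Q (p + 1) = [:B p, A p:] * Q p - smult (C p) (if p = 0 then 0 else Q (p - 1)))"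

definition S :: "(nat \<Rightarrow> real) \<Rightarrow> (nat \<Rightarrow> real) \<Rightarrow> nat \<Rightarrow> real \<Rightarrow> real" where
  "S A B i x = A i * x + B i"

definition T :: "(nat \<Rightarrow> real) \<Rightarrow> (nat \<Rightarrow> real) \<Rightarrow> (nat \<Rightarrow> real) \<Rightarrow> nat \<Rightarrow> real \<Rightarrow> real" where
  "T A B C i x = S A B i x / C i"

definition D :: "(nat \<Rightarrow> real) \<Rightarrow> nat \<Rightarrow> real" where
  "D C i = 1 / C i"

(* Psi A B C p j s is the degree-increase coefficient with subscript p + s and superscript j.
   It is meaningful for p \<ge> 1, s \<ge> 1 and j \<in> {p, p - 1}; the value at s = 0 is left unspecified. *)
fun Psi :: "(nat \<Rightarrow> real) \<Rightarrow> (nat \<Rightarrow> real) \<Rightarrow> (nat \<Rightarrow> real) \<Rightarrow> nat \<Rightarrow> nat \<Rightarrow> nat \<Rightarrow> real \<Rightarrow> real" where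
  "Psi A B C p j 0 x = undefined"
| "Psi A B C p j (Suc 0) x = (if j = p then S A B p x else - C p)"
| "Psi A B C p j (Suc (Suc 0)) x =
     (if j = p then S A B (p + 1) x * S A B p x - C (p + 1) else - C p * S A B (p + 1) x)"
| "Psi A B C p j (Suc (Suc (Suc n))) x =
     (let s = n + 3 in
        S A B (p + s - 1) x * Psi A B C p j (Suc (Suc n)) x
          - C (p + s - 1) * Psi A B C p j (Suc n) x)"

(* psi A B C p j t is the degree-decrease coefficient with subscript p - t and superscript j.
   It is meaningful for 1 \<le> t \<le> p and j \<in> {p, p - 1}; within this range no natural-number
   subtraction below truncates. *)
fun psi :: "(nat \<Rightarrow> real) \<Rightarrow> (nat \<Rightarrow> real) \<Rightarrow> (nat \<Rightarrow> real) \<Rightarrow> nat \<Rightarrow> nat \<Rightarrow> nat \<Rightarrow> real \<Rightarrow> real" where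
  "psi A B C p j 0 x = undefined"
| "psi A B C p j (Suc 0) x = (if j = p then 0 else 1)"
| "psi A B C p j (Suc (Suc 0)) x = (if j = p then - D C (p - 1) else T A B C (p - 1) x)"
| "psi A B C p j (Suc (Suc (Suc n))) x =
     (let t = n + 3 in
        T A B C (p - t + 1) x * psi A B C p j (Suc (Suc n)) x
          - D C (p - t + 1) * psi A B C p j (Suc n) x)"

definition K_matrix ::
  "(nat \<Rightarrow> real) \<Rightarrow> (nat \<Rightarrow> real) \<Rightarrow> (nat \<Rightarrow> real) \<Rightarrow> nat \<Rightarrow> nat \<Rightarrow> nat \<Rightarrow> real \<Rightarrow> real^2^2" where
  "K_matrix A B C p s t x =
     vector [vector [Psi A B C p p s x, Psi A B C p (p - 1) s x],
             vector [psi A B C p p t x, psi A B C p (p - 1) t x]]"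

end

theory Submission
  imports Defs
begin

text \<open>
  The Favard recurrence is a linear three-term recurrence, so at each point \<open>x\<close> every value
  \<open>Q k x\<close> is a linear combination of the two consecutive values \<open>Q p x\<close> and
  \<open>Q (p - 1) x\<close>. Running the recurrence upwards, the coefficients are the \<open>Psi\<close>
  (lemma \<open>degree_increase\<close>); running it downwards, which is possible because \<open>C k \<noteq> 0\<close>
  for \<open>k \<ge> 1\<close>, they are the \<open>psi\<close> (lemma \<open>degree_decrease\<close>). Hence
  \<open>K\<close> maps the vector with entries \<open>Q p x\<close>, \<open>Q (p - 1) x\<close> to the one with entries
  \<open>Q (p + s) x\<close>, \<open>Q (p - t) x\<close>, and Cramer's rule for the first unknown is the claim.
\<close>

lemma favard_step_up:
  assumes "favard_recurrence A B C Q" and "k \<ge> 1"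
  shows "poly (Q (Suc k)) x = S A B k x * poly (Q k) x - C k * poly (Q (k - 1)) x"
proof -
  have "Q (k + 1) = [:B k, A k:] * Q k - smult (C k) (Q (k - 1))"
    using assms unfolding favard_recurrence_def by auto
  then have "poly (Q (Suc k)) x = poly ([:B k, A k:] * Q k - smult (C k) (Q (k - 1))) x"
    by simp
  then show ?thesis
    by (simp add: S_def algebra_simps)
qed

lemma favard_step_down:
  assumes "favard_recurrence A B C Q" and "k \<ge> 1" and "C k \<noteq> 0"
  shows "poly (Q (k - 1)) x = T A B C k x * poly (Q k) x - D C k * poly (Q (Suc k)) x"
  using favard_step_up[OF assms(1,2), of x] assms(3)
  by (simp add: T_def D_def field_simps)

text \<open>
  Both sides satisfy the same second-order recurrence in \<open>n\<close>, so two initial values decide.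
  The offset \<open>Suc n\<close> keeps clear of the unspecified value of \<open>Psi\<close> at step \<open>0\<close>.
\<close>

lemma degree_increase:
  assumes rec: "favard_recurrence A B C Q" and p: "p \<ge> 1"
  shows "poly (Q (p + Suc n)) x =
    Psi A B C p p (Suc n) x * poly (Q p) x
    + Psi A B C p (p - 1) (Suc n) x * poly (Q (p - 1)) x"
proof (induction n rule: induct_nat_012)
  case 0
  from p have "p - 1 \<noteq> p" by simp
  then show ?case
    using favard_step_up[OF rec p, of x] by simp
next
  case 1
  from p have neq: "(p - 1 = p) = False" by simp
  have "poly (Q (Suc (Suc p))) x =
      S A B (Suc p) x * poly (Q (Suc p)) x - C (Suc p) * poly (Q p) x"
    using favard_step_up[OF rec, of "Suc p" x] by simp
  then show ?case
    unfolding Psi.simps neq if_False favard_step_up[OF rec p]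
    by (simp add: algebra_simps)
next
  case (ge2 n)
  have "poly (Q (p + Suc (Suc (Suc n)))) x =
      S A B (p + Suc (Suc n)) x * poly (Q (p + Suc (Suc n))) x
      - C (p + Suc (Suc n)) * poly (Q (p + Suc n)) x"
    using favard_step_up[OF rec, of "p + Suc (Suc n)" x] by simp
  then show ?case
    unfolding ge2.IH by (simp add: Let_def algebra_simps)
qed

text \<open>
  The mirror image, with the recurrence solved for its lowest term. The range \<open>Suc n \<le> p\<close> is
  exactly where this division by \<open>C (p - n)\<close> only meets indices that are at least \<open>1\<close>.
\<close>

lemma degree_decrease:
  assumes rec: "favard_recurrence A B C Q" and C: "\<And>k. k \<ge> 1 \<Longrightarrow> C k \<noteq> 0"
    and "Suc n \<le> p"
  shows "poly (Q (p - Suc n)) x =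
    psi A B C p p (Suc n) x * poly (Q p) x
    + psi A B C p (p - 1) (Suc n) x * poly (Q (p - 1)) x"
  using assms(3)
proof (induction n rule: induct_nat_012)
  case 0
  then have "p - 1 \<noteq> p" by simp
  then show ?case by simp
next
  case 1
  then have p1: "p - 1 \<ge> 1" and idx: "Suc (p - 1) = p" "p - 1 - 1 = p - Suc (Suc 0)"
    and neq: "(p - 1 = p) = False"
    by simp_all
  from favard_step_down[OF rec p1 C[OF p1], of x] show ?case
    unfolding psi.simps neq if_False idx by simp
next
  case (ge2 n)
  define k where "k = p - Suc (Suc n)"
  have k: "k \<ge> 1" "k - 1 = p - Suc (Suc (Suc n))" "Suc k = p - Suc n"
    using ge2.prems by (simp_all add: k_def)
  have idx: "p - (n + 3) + 1 = k"
    using ge2.prems by (simp add: k_def)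
  have "poly (Q (p - Suc (Suc (Suc n)))) x =
      T A B C k x * poly (Q (p - Suc (Suc n))) x - D C k * poly (Q (p - Suc n)) x"
    using favard_step_down[OF rec k(1) C[OF k(1)], of x] unfolding k(2,3) by (simp add: k_def)
  moreover have "Suc n \<le> p" "Suc (Suc n) \<le> p"
    using ge2.prems by simp_all
  ultimately show ?case
    unfolding psi.simps Let_def idx using ge2.IH by (simp add: algebra_simps)
qed

theorem mainTheorem5:
  fixes A B C :: "nat \<Rightarrow> real" and Q :: "nat \<Rightarrow> real poly"
    and p s t :: nat and x :: real
  assumes "favard_coeffs A C"
    and "favard_recurrence A B C Q"
    and "1 \<le> t" and "t \<le> p" and "s \<ge> 1"
    and "Psi A B C p (p - 1) s x \<noteq> 0"
    and "psi A B C p (p - 1) t x \<noteq> 0"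
    and "det (K_matrix A B C p s t x) \<noteq> 0"
  shows "poly (Q p) x =
     (psi A B C p (p - 1) t x / det (K_matrix A B C p s t x)) * poly (Q (p + s)) x
     + (- (Psi A B C p (p - 1) s x / det (K_matrix A B C p s t x))) * poly (Q (p - t)) x"
proof -
  let ?d = "det (K_matrix A B C p s t x)"
  let ?a = "Psi A B C p p s x" and ?b = "Psi A B C p (p - 1) s x"
  let ?c = "psi A B C p p t x" and ?e = "psi A B C p (p - 1) t x"
  have C: "\<And>k. k \<ge> 1 \<Longrightarrow> C k \<noteq> 0"
    using assms(1) by (simp add: favard_coeffs_def)
  have det: "?d = ?a * ?e - ?b * ?c"
    by (simp add: K_matrix_def det_2)
  have up: "poly (Q (p + s)) x = ?a * poly (Q p) x + ?b * poly (Q (p - 1)) x"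
    using degree_increase[OF assms(2), of p "s - 1" x] assms(3-5) by simp
  have down: "poly (Q (p - t)) x = ?c * poly (Q p) x + ?e * poly (Q (p - 1)) x"
    using degree_decrease[OF assms(2) C, of "t - 1" p x] assms(3,4) by simp
  \<comment> \<open>Eliminating \<open>Q (p - 1)\<close> from the two relations leaves the determinant as coefficient.\<close>
  have "?d * poly (Q p) x = ?e * poly (Q (p + s)) x - ?b * poly (Q (p - t)) x"
    unfolding up down det by (simp add: algebra_simps)
  then show ?thesis
    using assms(8) by (simp add: field_simps)
qed

end
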